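(* The maximum capture problem (MCP) under the cross-nested logit (CNL) model, $$\text{(P1)}\quad\max\left\{F(x)=\sum_{t\in[T]}q_t\,\frac{\sum_{n\in[N]}W_{tn}^{\sigma_{tn}-1}\left(\sum_{i\in[m]}\alpha^t_{in}V_{tin}x_i\right)}{\sum_{n\in[N]}W_{tn}^{\sigma_{tn}}}\ :\ x\in\{0,1\}^m,\ \sum_{i\in[m]}x_i\le r\right\},$$ where $W_{tn}=\sum_{i\in[m]}\alpha^t_{in}V_{tin}x_i+U^c_{tn}$, is equivalent to the following mixed-integer nonlinear convex program (a program with linear objective and convex constraints, apart from integrality of $x$): $$\text{(P2)}\quad\begin{aligned}\max_{x,y,z,\theta,W}\quad&\sum_{t\in[T]}q_t-\sum_{t\in[T]}\sum_{n\in[N]}q_t\theta_{tn}\\ \text{s.t.}\quad&\theta_{tn}\ge\exp(y_{tn}-z_t),&&\forall t\in[T],n\in[N],\\ &y_{tn}\ge(\sigma_{tn}-1)\log(W_{tn})+\log(U^c_{tn}),&&\forall t\in[T],n\in[N],\\ &z_t\le\log\Big(\sum_{n\in[N]}W_{tn}^{\sigma_{tn}}\Big),&&\forall t\in[T],\\ &W_{tn}=\sum_{i\in[m]}\alpha^t_{in}V_{tin}x_i+U^c_{tn},&&\forall t\in[T],n\in[N],\\ &\sum_{i\in[m]}x_i=r,\\ &x\in\{0,1\}^m,\ y,W,\theta\in\mathbb{R}^{T\times N},\ z\in\mathbb{R}^T.\end{aligned}$$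
   Context: Notation: $[k]=\{1,\dots,k\}$. $[T]$ is the set of customer types, $[m]$ the set of candidate locations, $\mathcal{C}$ the set of the competitor's existing facilities, $[N]$ indexes the nests, and $r$ is the maximum number of facilities to open; $x_i=1$ if and only if location $i$ is chosen. $q_t$ is the total demand of customers of type $t$; $\sigma_{tn}\in(0,1]$ are the dissimilarity parameters of the nests; $\alpha^t_{in}\ge0$ ($i\in[m]\cup\mathcal{C}$) is the level of membership of $i$ in nest $n$ for customer type $t$ (equal to $0$ if $i$ does not belong to the nest), with $\sum_{n\in[N]}\alpha^t_{in}=1$ for all $i\in[m]$; $V_{tin}=e^{v_{ti}/\sigma_{tn}}$, where $v_{ti}$ is the given deterministic utility of $i$ for customers of type $t$. Competitor and new facilities may share nests, and $U^c_{tn}=\sum_{i\in\mathcal{C}}\alpha^t_{in}V_{tin}$.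
   Formalization: It is assumed in addition that U^c_tn > 0 for all t and n (otherwise log(U^c_tn) in (P2) is undefined) and that r ≤ m (otherwise (P2) is infeasible while (P1) is not). *)

theory Defs
  imports "HOL-Analysis.Analysis"
begin

text \<open>
  Mathematical programs in maximisation form. The functions in \<open>binaries\<close> are required to
  take values in \<open>{0, 1}\<close>; \<open>dom\<close> is the set on which the (partially defined) constraint
  functions make sense.
\<close>

record 'v program =
  dom :: "'v set"
  objective :: "'v \<Rightarrow> real"
  ineqs :: "('v \<Rightarrow> real) set"
  eqs :: "('v \<Rightarrow> real) set"
  binaries :: "('v \<Rightarrow> real) set"

definition feasible :: "'v program \<Rightarrow> 'v set" where
  "feasible P = {p \<in> dom P. (\<forall>g\<in>ineqs P. g p \<le> 0) \<and> (\<forall>h\<in>eqs P. h p = 0) \<and>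
     (\<forall>b\<in>binaries P. b p \<in> {0, 1})}"

definition optimal :: "'v program \<Rightarrow> 'v \<Rightarrow> bool" where
  "optimal P p \<longleftrightarrow> is_arg_max (objective P) (\<lambda>p. p \<in> feasible P) p"

definition affine_fun :: "('v::real_vector \<Rightarrow> real) \<Rightarrow> bool" where
  "affine_fun f \<longleftrightarrow> linear (\<lambda>p. f p - f 0)"

text \<open>
  A linear objective may carry an additive constant, hence \<^const>\<open>affine_fun\<close> below.
\<close>

definition mixed_binary_convex_program :: "'v::real_vector program \<Rightarrow> bool" where
  "mixed_binary_convex_program P \<longleftrightarrow>
     convex (dom P) \<and> affine_fun (objective P) \<and>
     finite (ineqs P) \<and> (\<forall>g\<in>ineqs P. convex_on (dom P) g) \<and>
     finite (eqs P) \<and> (\<forall>h\<in>eqs P. affine_fun h) \<and>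
     finite (binaries P) \<and> (\<forall>b\<in>binaries P. linear b)"

text \<open>
  Index types: \<open>'t\<close> customer types, \<open>'n\<close> nests, \<open>'m\<close> candidate locations, \<open>'c\<close> facilities of
  the competitor. A facility is an element of \<open>'m + 'c\<close>. Here \<open>\<sigma> t n\<close> is the dissimilarity
  parameter, \<open>\<alpha> t i n\<close> the membership of \<open>i\<close> in nest \<open>n\<close>, \<open>v t i\<close> the deterministic utility and
  \<open>q t\<close> the demand.
\<close>

definition V :: "('t \<Rightarrow> 'n \<Rightarrow> real) \<Rightarrow> ('t \<Rightarrow> 'i \<Rightarrow> real) \<Rightarrow> 't \<Rightarrow> 'i \<Rightarrow> 'n \<Rightarrow> real" where
  "V \<sigma> v t i n = exp (v t i / \<sigma> t n)"

definition Uc :: "('t \<Rightarrow> 'n \<Rightarrow> real) \<Rightarrow> ('t \<Rightarrow> 'm + 'c::finite \<Rightarrow> 'n \<Rightarrow> real) \<Rightarrow>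
    ('t \<Rightarrow> 'm + 'c \<Rightarrow> real) \<Rightarrow> 't \<Rightarrow> 'n \<Rightarrow> real" where
  "Uc \<sigma> \<alpha> v t n = (\<Sum>j\<in>UNIV. \<alpha> t (Inr j) n * V \<sigma> v t (Inr j) n)"

definition new_attraction :: "('t \<Rightarrow> 'n \<Rightarrow> real) \<Rightarrow> ('t \<Rightarrow> 'm + 'c \<Rightarrow> 'n \<Rightarrow> real) \<Rightarrow>
    ('t \<Rightarrow> 'm + 'c \<Rightarrow> real) \<Rightarrow> real ^ 'm::finite \<Rightarrow> 't \<Rightarrow> 'n \<Rightarrow> real" where
  "new_attraction \<sigma> \<alpha> v x t n = (\<Sum>i\<in>UNIV. \<alpha> t (Inl i) n * V \<sigma> v t (Inl i) n * x $ i)"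

definition nest_weight :: "('t \<Rightarrow> 'n \<Rightarrow> real) \<Rightarrow> ('t \<Rightarrow> 'm + 'c::finite \<Rightarrow> 'n \<Rightarrow> real) \<Rightarrow>
    ('t \<Rightarrow> 'm + 'c \<Rightarrow> real) \<Rightarrow> real ^ 'm::finite \<Rightarrow> 't \<Rightarrow> 'n \<Rightarrow> real" where
  "nest_weight \<sigma> \<alpha> v x t n = new_attraction \<sigma> \<alpha> v x t n + Uc \<sigma> \<alpha> v t n"

definition captured_demand :: "('t::finite \<Rightarrow> real) \<Rightarrow> ('t \<Rightarrow> 'n::finite \<Rightarrow> real) \<Rightarrow>
    ('t \<Rightarrow> 'm + 'c::finite \<Rightarrow> 'n \<Rightarrow> real) \<Rightarrow> ('t \<Rightarrow> 'm + 'c \<Rightarrow> real) \<Rightarrow> real ^ 'm::finite \<Rightarrow> real" where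
  "captured_demand q \<sigma> \<alpha> v x =
     (\<Sum>t\<in>UNIV. q t *
        ((\<Sum>n\<in>UNIV. nest_weight \<sigma> \<alpha> v x t n powr (\<sigma> t n - 1) * new_attraction \<sigma> \<alpha> v x t n) /
         (\<Sum>n\<in>UNIV. nest_weight \<sigma> \<alpha> v x t n powr \<sigma> t n)))"

definition MCP :: "('t::finite \<Rightarrow> real) \<Rightarrow> ('t \<Rightarrow> 'n::finite \<Rightarrow> real) \<Rightarrow>
    ('t \<Rightarrow> 'm + 'c::finite \<Rightarrow> 'n \<Rightarrow> real) \<Rightarrow> ('t \<Rightarrow> 'm + 'c \<Rightarrow> real) \<Rightarrow> nat \<Rightarrow>
    (real ^ 'm::finite) program" where
  "MCP q \<sigma> \<alpha> v r =
     \<lparr>dom = UNIV,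
      objective = captured_demand q \<sigma> \<alpha> v,
      ineqs = {\<lambda>x. (\<Sum>i\<in>UNIV. x $ i) - real r},
      eqs = {},
      binaries = {\<lambda>x. x $ i | i. True}\<rparr>"

text \<open>
  The variables of the reformulation are tuples \<open>(x, y, z, \<theta>, W)\<close>. Its domain \<open>W > 0\<close> is the
  natural domain of the logarithms; see \<open>feasible_CP_iff\<close> for the constraints in their usual form.
\<close>

type_synonym ('t, 'n, 'm) vars =
  "(real ^ 'm) \<times> (real ^ 'n ^ 't) \<times> (real ^ 't) \<times> (real ^ 'n ^ 't) \<times> (real ^ 'n ^ 't)"

definition CP :: "('t::finite \<Rightarrow> real) \<Rightarrow> ('t \<Rightarrow> 'n::finite \<Rightarrow> real) \<Rightarrow>
    ('t \<Rightarrow> 'm + 'c::finite \<Rightarrow> 'n \<Rightarrow> real) \<Rightarrow> ('t \<Rightarrow> 'm + 'c \<Rightarrow> real) \<Rightarrow> nat \<Rightarrow>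
    ('t, 'n, 'm::finite) vars program" where
  "CP q \<sigma> \<alpha> v r =
     \<lparr>dom = {(x, y, z, \<theta>, W). \<forall>t n. W $ t $ n > 0},
      objective = (\<lambda>(x, y, z, \<theta>, W).
        (\<Sum>t\<in>UNIV. q t) - (\<Sum>t\<in>UNIV. \<Sum>n\<in>UNIV. q t * \<theta> $ t $ n)),
      ineqs =
        {\<lambda>(x, y, z, \<theta>, W). exp (y $ t $ n - z $ t) - \<theta> $ t $ n | t n. True} \<union>
        {\<lambda>(x, y, z, \<theta>, W). (\<sigma> t n - 1) * ln (W $ t $ n) + ln (Uc \<sigma> \<alpha> v t n) - y $ t $ n
          | t n. True} \<union>
        {\<lambda>(x, y, z, \<theta>, W). z $ t - ln (\<Sum>n\<in>UNIV. W $ t $ n powr \<sigma> t n) | t. True},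
      eqs =
        {\<lambda>(x, y, z, \<theta>, W). W $ t $ n - nest_weight \<sigma> \<alpha> v x t n | t n. True} \<union>
        {\<lambda>(x, y, z, \<theta>, W). (\<Sum>i\<in>UNIV. x $ i) - real r},
      binaries = {\<lambda>(x, y, z, \<theta>, W). x $ i | i. True}\<rparr>"

lemma feasible_MCP_iff:
  "x \<in> feasible (MCP q \<sigma> \<alpha> v r) \<longleftrightarrow> (\<forall>i. x $ i \<in> {0, 1}) \<and> (\<Sum>i\<in>UNIV. x $ i) \<le> real r"
  by (auto simp: feasible_def MCP_def)

lemma nest_weight_pos:
  assumes "\<And>t i n. \<alpha> t i n \<ge> 0" and "\<And>t n. Uc \<sigma> \<alpha> v t n > 0" and "\<And>i. x $ i \<ge> 0"
  shows "nest_weight \<sigma> \<alpha> v x t n > 0"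
  unfolding nest_weight_def new_attraction_def V_def
  by (intro add_nonneg_pos sum_nonneg mult_nonneg_nonneg assms exp_ge_zero)

lemma feasible_CP_iff:
  assumes "\<And>t i n. \<alpha> t i n \<ge> 0" and "\<And>t n. Uc \<sigma> \<alpha> v t n > 0"
  shows "(x, y, z, \<theta>, W) \<in> feasible (CP q \<sigma> \<alpha> v r) \<longleftrightarrow>
    (\<forall>t n. \<theta> $ t $ n \<ge> exp (y $ t $ n - z $ t)) \<and>
    (\<forall>t n. y $ t $ n \<ge> (\<sigma> t n - 1) * ln (W $ t $ n) + ln (Uc \<sigma> \<alpha> v t n)) \<and>
    (\<forall>t. z $ t \<le> ln (\<Sum>n\<in>UNIV. W $ t $ n powr \<sigma> t n)) \<and>
    (\<forall>t n. W $ t $ n =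
       (\<Sum>i\<in>UNIV. \<alpha> t (Inl i) n * V \<sigma> v t (Inl i) n * x $ i) + Uc \<sigma> \<alpha> v t n) \<and>
    (\<Sum>i\<in>UNIV. x $ i) = real r \<and>
    (\<forall>i. x $ i \<in> {0, 1})" (is "_ \<longleftrightarrow> ?R")
proof -
  have pos: "W $ t $ n > 0" if ?R for t n
  proof -
    have "x $ i \<ge> 0" for i
      using that by (metis insertE singletonD order_refl zero_le_one)
    from nest_weight_pos[OF assms this, of t n] that show ?thesis
      by (simp add: nest_weight_def new_attraction_def)
  qed
  have "(x, y, z, \<theta>, W) \<in> feasible (CP q \<sigma> \<alpha> v r) \<longleftrightarrow> (\<forall>t n. W $ t $ n > 0) \<and> ?R"
    unfolding feasible_def CP_def nest_weight_def new_attraction_def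
    by (simp add: Ball_def ex_disj_distrib all_conj_distrib conj_disj_distribL imp_conjL)
       fastforce
  with pos show ?thesis by blast
qed

end

theory Submission
  imports Defs
begin

text \<open>
  Since \<open>new_attraction = nest_weight - Uc\<close>, the captured demand equals
  \<open>\<Sum>t. q t - \<Sum>t n. q t * (W\<^bsub>tn\<^esub> powr (\<sigma>\<^bsub>tn\<^esub> - 1) * U\<^bsub>tn\<^esub> / (\<Sum>k. W\<^bsub>tk\<^esub> powr \<sigma>\<^bsub>tk\<^esub>))\<close>.
  Because \<open>\<sigma> \<le> 1\<close>, each lost fraction is antitone in \<open>W\<close>, hence in \<open>x\<close>, so opening more facilities
  never hurts and the budget may be taken to be exhausted. In the convex program the constraints
  force \<open>\<theta>\<^bsub>tn\<^esub>\<close> to be at least the lost fraction, and this bound is attained by making all the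
  inequalities tight. The third family of constraints is convex because \<open>ln (\<Sum>n. W\<^bsub>tn\<^esub> powr \<sigma>\<^bsub>tn\<^esub>)\<close>
  is an increasing concave function of a sum of concave functions.
\<close>

section \<open>Convexity\<close>

lemma convex_on_compose_linear:
  assumes "linear L" "convex_on B f" "convex A" "L ` A \<subseteq> B"
  shows "convex_on A (\<lambda>p. f (L p))"
proof (rule convex_onI)
  fix t :: real and x y
  assume "0 < t" "t < 1" "x \<in> A" "y \<in> A"
  then show "f (L ((1 - t) *\<^sub>R x + t *\<^sub>R y)) \<le> (1 - t) * f (L x) + t * f (L y)"
    using convex_onD[OF assms(2), of t "L x" "L y"] assms(4)
    by (auto simp: linear_add[OF assms(1)] linear_scale[OF assms(1)])
qed (rule assms)

lemma concave_on_compose_linear: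
  assumes "linear L" "concave_on B f" "convex A" "L ` A \<subseteq> B"
  shows "concave_on A (\<lambda>p. f (L p))"
  using convex_on_compose_linear[OF assms(1) _ assms(3,4)] assms(2) unfolding concave_on_def .

lemma concave_on_linear:
  fixes f :: "'a::real_vector \<Rightarrow> real"
  assumes "linear f" "convex A"
  shows "concave_on A f"
  using assms by (simp add: concave_on_iff linear_add linear_scale)

lemma convex_on_linear:
  fixes f :: "'a::real_vector \<Rightarrow> real"
  assumes "linear f" "convex A"
  shows "convex_on A f"
  using assms by (simp add: convex_on_def linear_add linear_scale)

text \<open>Concavity of \<open>g\<close> bounds the mean of the values by \<open>g\<close> at the
  mean of \<open>f x\<close> and \<open>f y\<close>; concavity of \<open>f\<close> and monotonicity
  of \<open>g\<close> then move the argument up to \<open>f\<close> at the combined point.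
  Monotonicity only on \<open>B\<close> lets the lemma apply to \<open>ln\<close> on the positive
  reals.\<close>

lemma concave_on_compose_mono:
  fixes g :: "real \<Rightarrow> real"
  assumes "concave_on A f" "concave_on B g" "mono_on B g" "f ` A \<subseteq> B"
  shows "concave_on A (\<lambda>p. g (f p))"
  unfolding concave_on_iff
proof (intro conjI ballI allI impI)
  show A: "convex A"
    using assms(1) by (rule concave_on_imp_convex)
  fix x y u v
  assume xy: "x \<in> A" "y \<in> A" and uv: "0 \<le> u" "0 \<le> v" "u + v = (1::real)"
  have fxy: "f x \<in> B" "f y \<in> B" "f (u *\<^sub>R x + v *\<^sub>R y) \<in> B"
    using assms(4) xy convexD[OF A xy uv] by auto
  have B: "convex B"
    using assms(2) by (rule concave_on_imp_convex)
  have "u * g (f x) + v * g (f y) \<le> g (u * f x + v * f y)"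
    using assms(2) fxy uv unfolding concave_on_iff by auto
  also have "\<dots> \<le> g (f (u *\<^sub>R x + v *\<^sub>R y))"
  proof (rule mono_onD[OF assms(3)])
    show "u * f x + v * f y \<in> B"
      using convexD[OF B fxy(1,2) uv] by simp
    show "u * f x + v * f y \<le> f (u *\<^sub>R x + v *\<^sub>R y)"
      using assms(1) xy uv unfolding concave_on_iff by auto
  qed (rule fxy)
  finally show "u * g (f x) + v * g (f y) \<le> g (f (u *\<^sub>R x + v *\<^sub>R y))" .
qed

lemma concave_on_sum_fun:
  assumes "convex A" "\<And>i. i \<in> I \<Longrightarrow> concave_on A (f i)"
  shows "concave_on A (\<lambda>x. \<Sum>i\<in>I. f i x)"
  using assms(2)
  \<comment> \<open>A sum over an empty or infinite index set is the constant 0, whose concavity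
    rests on \<open>convex A\<close>.\<close>
  by (induction I rule: infinite_finite_induct)
     (auto simp: assms(1) concave_on_const intro!: concave_on_add)

text \<open>The second derivative \<open>a * (a - 1) * x powr (a - 2)\<close> is nonpositive, since
  \<open>a\<close> is nonnegative and \<open>a - 1\<close> is nonpositive.\<close>

lemma powr_concave:
  fixes a :: real
  assumes "0 \<le> a" "a \<le> 1"
  shows "concave_on {0<..} (\<lambda>x. x powr a)"
proof (rule f''_le0_imp_concave)
  fix x :: real assume "x \<in> {0<..}"
  then have x: "x > 0" by simp
  show "((\<lambda>x. x powr a) has_real_derivative a * x powr (a - 1)) (at x)"
    using x by (rule has_real_derivative_powr)
  show "((\<lambda>x. a * x powr (a - 1)) has_real_derivative a * ((a - 1) * x powr (a - 2))) (at x)"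
    using DERIV_cmult[OF has_real_derivative_powr[OF x, of "a - 1"], of a] by simp
  show "a * ((a - 1) * x powr (a - 2)) \<le> 0"
    using assms by (intro mult_nonneg_nonpos mult_nonpos_nonneg) auto
qed simp

text \<open>With \<open>W\<close> as separate variables tied to \<open>x\<close> by affine
  equations, each nonlinear term depends only on linear coordinates of the tuple, so convexity
  reduces to facts about \<open>exp\<close>, \<open>ln\<close> and \<open>powr\<close> on the
  reals.\<close>

lemma mixed_binary_convex_program_CP:
  fixes \<alpha> :: "'t::finite \<Rightarrow> 'm::finite + 'c::finite \<Rightarrow> 'n::finite \<Rightarrow> real"
  assumes \<sigma>: "\<And>t n. 0 \<le> \<sigma> t n \<and> \<sigma> t n \<le> 1"
  shows "mixed_binary_convex_program (CP q \<sigma> \<alpha> v r)"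
proof -
  define D :: "('t, 'n, 'm) vars set" where "D = {(x, y, z, \<theta>, W). \<forall>t n. W $ t $ n > 0}"
  have lin:
    "linear (\<lambda>p::('t, 'n, 'm) vars. fst p $ i)"
    "linear (\<lambda>p::('t, 'n, 'm) vars. fst (snd p) $ t $ n)"
    "linear (\<lambda>p::('t, 'n, 'm) vars. fst (snd (snd p)) $ t)"
    "linear (\<lambda>p::('t, 'n, 'm) vars. fst (snd (snd (snd p))) $ t $ n)"
    "linear (\<lambda>p::('t, 'n, 'm) vars. snd (snd (snd (snd p))) $ t $ n)" for i t n
    by (auto intro!: linearI)
  \<comment> \<open>The domain is an intersection of open half-spaces, written as linear preimages
    of the positive ray.\<close>
  have "D = (\<Inter>t. \<Inter>n. (\<lambda>p. snd (snd (snd (snd p))) $ t $ n) -` {0<..})"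
    by (auto simp: D_def)
  then have D: "convex D"
    by (auto intro!: convex_INT convex_linear_vimage lin)
  have WD: "(\<lambda>p. snd (snd (snd (snd p))) $ t $ n) ` D \<subseteq> {0<..}" for t n
    by (auto simp: D_def)

  have share: "convex_on D (\<lambda>(x, y, z, \<theta>, W). exp (y $ t $ n - z $ t) - \<theta> $ t $ n)" for t n
    unfolding case_prod_beta'
    by (intro convex_on_diff convex_on_compose_linear[OF _ exp_convex] concave_on_linear
        linear_compose_sub lin D) auto
  have log_num: "convex_on D (\<lambda>(x, y, z, \<theta>, W).
      (\<sigma> t n - 1) * ln (W $ t $ n) + ln (Uc \<sigma> \<alpha> v t n) - y $ t $ n)" for t n
  proof -
    \<comment> \<open>The sign is flipped so that the factor \<open>1 - \<sigma> t n\<close> is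
      nonnegative and preserves the concavity of \<open>ln\<close>.\<close>
    have "concave_on D (\<lambda>p. (1 - \<sigma> t n) * ln (snd (snd (snd (snd p))) $ t $ n))"
      using \<sigma> by (intro concave_on_cmul concave_on_compose_linear[OF _ ln_concave] lin D WD) auto
    then have "convex_on D (\<lambda>p. (\<sigma> t n - 1) * ln (snd (snd (snd (snd p))) $ t $ n))"
      unfolding concave_on_def by (simp add: algebra_simps)
    then show ?thesis
      unfolding case_prod_beta'
      by (intro convex_on_diff convex_on_add concave_on_linear lin D)
         (simp_all add: convex_on_const D)
  qed
  have log_den: "convex_on D (\<lambda>(x, y, z, \<theta>, W). z $ t - ln (\<Sum>n\<in>UNIV. W $ t $ n powr \<sigma> t n))" for t
  proof -
    have "concave_on D (\<lambda>p. \<Sum>n\<in>UNIV. (snd (snd (snd (snd p))) $ t $ n) powr \<sigma> t n)"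
      using \<sigma>
      by (intro concave_on_sum_fun concave_on_compose_linear[OF _ powr_concave] lin D WD) auto
    \<comment> \<open>On \<open>D\<close> the sum has positive terms over a nonempty finite type, so
      it lands where \<open>ln\<close> is increasing and concave.\<close>
    then have "concave_on D (\<lambda>p. ln (\<Sum>n\<in>UNIV. (snd (snd (snd (snd p))) $ t $ n) powr \<sigma> t n))"
      by (rule concave_on_compose_mono[OF _ ln_concave])
         (auto simp: D_def less_imp_neq[THEN not_sym] intro!: mono_onI sum_pos)
    then show ?thesis
      unfolding case_prod_beta' by (intro convex_on_diff convex_on_linear lin D)
  qed
  have fin2: "finite {g. \<exists>t n. g = f t n}" for f :: "'t \<Rightarrow> 'n \<Rightarrow> ('t, 'n, 'm) vars \<Rightarrow> real"
    using finite_image_set2[of "\<lambda>_. True" "\<lambda>_. True" f] by simp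
  show ?thesis
    unfolding mixed_binary_convex_program_def CP_def program.simps D_def[symmetric]
  proof (intro conjI)
    show "affine_fun (\<lambda>(x, y, z, \<theta>, W).
        (\<Sum>t\<in>UNIV. q t) - (\<Sum>t\<in>UNIV. \<Sum>n\<in>UNIV. q t * \<theta> $ t $ n) :: real)"
      unfolding affine_fun_def case_prod_beta'
      by (auto intro!: linearI simp: sum.distrib algebra_simps sum_distrib_left)
    show "\<forall>h\<in>{\<lambda>(x, y, z, \<theta>, W). W $ t $ n - nest_weight \<sigma> \<alpha> v x t n | t n. True} \<union>
        {\<lambda>(x, y, z, \<theta>, W). (\<Sum>i\<in>UNIV. x $ i) - real r}. affine_fun h"
      unfolding affine_fun_def nest_weight_def new_attraction_def
      by (auto intro!: linearI simp: case_prod_beta' sum.distrib algebra_simps sum_distrib_left)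
    show "\<forall>b\<in>{\<lambda>(x, y, z, \<theta>, W). x $ i | i. True}. linear b"
      by (auto intro!: linearI)
  qed (use D share log_num log_den in \<open>auto intro!: fin2 simp: full_SetCompr_eq\<close>)
qed

section \<open>The captured demand\<close>

text \<open>Gathers the sign conditions for comparing the programs. By \<open>Uc_pos\<close> all
  nest weights are positive even when nothing is opened, so the logarithms and quotients below are
  genuine.\<close>

locale cross_nested_logit =
  fixes q :: "'t::finite \<Rightarrow> real"
    and \<sigma> :: "'t \<Rightarrow> 'n::finite \<Rightarrow> real"
    and \<alpha> :: "'t \<Rightarrow> 'm::finite + 'c::finite \<Rightarrow> 'n \<Rightarrow> real"
    and v :: "'t \<Rightarrow> 'm + 'c \<Rightarrow> real"
  assumes q_nonneg: "q t \<ge> 0"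
    and \<sigma>_nonneg: "0 \<le> \<sigma> t n"
    and \<sigma>_le_1: "\<sigma> t n \<le> 1"
    and \<alpha>_nonneg: "\<alpha> t i n \<ge> 0"
    and Uc_pos: "Uc \<sigma> \<alpha> v t n > 0"
begin

abbreviation W :: "real ^ 'm \<Rightarrow> 't \<Rightarrow> 'n \<Rightarrow> real" where
  "W \<equiv> nest_weight \<sigma> \<alpha> v"

text \<open>This is the probability that a customer of type \<open>t\<close> chooses a competitor
  facility through nest \<open>n\<close>: the nest probability, proportional to
  \<open>W powr \<sigma>\<close>, times the competitor's fraction \<open>Uc / W\<close> within the
  nest.\<close>

definition lost_share :: "real ^ 'm \<Rightarrow> 't \<Rightarrow> 'n \<Rightarrow> real" where
  "lost_share x t n = W x t n powr (\<sigma> t n - 1) * Uc \<sigma> \<alpha> v t n / (\<Sum>k\<in>UNIV. W x t k powr \<sigma> t k)"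

lemma W_pos: "(\<And>i. x $ i \<ge> 0) \<Longrightarrow> W x t n > 0"
  by (intro nest_weight_pos \<alpha>_nonneg Uc_pos)

lemma denominator_pos: "(\<And>i. x $ i \<ge> 0) \<Longrightarrow> (\<Sum>k\<in>UNIV. W x t k powr \<sigma> t k) > 0"
  using W_pos[of x] by (intro sum_pos) (auto simp: less_imp_neq[THEN not_sym])

lemma W_mono: "(\<And>i. x $ i \<le> x' $ i) \<Longrightarrow> W x t n \<le> W x' t n"
  unfolding nest_weight_def new_attraction_def V_def
  by (intro add_mono sum_mono mult_left_mono mult_nonneg_nonneg \<alpha>_nonneg) auto

lemma captured_demand_eq:
  assumes "\<And>i. x $ i \<ge> 0"
  shows "captured_demand q \<sigma> \<alpha> v x
    = (\<Sum>t\<in>UNIV. q t) - (\<Sum>t\<in>UNIV. \<Sum>n\<in>UNIV. q t * lost_share x t n)"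
proof -
  have "(\<Sum>n\<in>UNIV. W x t n powr (\<sigma> t n - 1) * new_attraction \<sigma> \<alpha> v x t n) /
      (\<Sum>n\<in>UNIV. W x t n powr \<sigma> t n) = 1 - (\<Sum>n\<in>UNIV. lost_share x t n)" for t
  proof -
    have "W x t n powr (\<sigma> t n - 1) * new_attraction \<sigma> \<alpha> v x t n
        = W x t n powr \<sigma> t n - W x t n powr (\<sigma> t n - 1) * Uc \<sigma> \<alpha> v t n" for n
    proof -
      have "W x t n powr \<sigma> t n = W x t n powr (\<sigma> t n - 1) * W x t n"
        using W_pos[OF assms, of t n] by (simp add: powr_diff)
      then show ?thesis
        by (simp add: nest_weight_def algebra_simps)
    qed
    then show ?thesis
      using denominator_pos[OF assms, of t]
      by (simp add: lost_share_def sum_subtractf diff_divide_distrib sum_divide_distrib[symmetric])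
  qed
  then show ?thesis
    by (simp add: captured_demand_def right_diff_distrib sum_subtractf sum_distrib_left)
qed

text \<open>The numerator falls because its exponent \<open>\<sigma> - 1\<close> is nonpositive; the
  denominator grows because \<open>\<sigma>\<close> is nonnegative.\<close>

lemma lost_share_antimono:
  assumes "\<And>i. x $ i \<ge> 0" "\<And>i. x $ i \<le> x' $ i"
  shows "lost_share x' t n \<le> lost_share x t n"
  unfolding lost_share_def
proof (rule frac_le)
  have "W x' t n powr (\<sigma> t n - 1) \<le> W x t n powr (\<sigma> t n - 1)"
    using W_pos[OF assms(1), of t n] W_mono[OF assms(2), of t n] \<sigma>_le_1[of t n]
    by (intro powr_mono2') auto
  then show "W x' t n powr (\<sigma> t n - 1) * Uc \<sigma> \<alpha> v t n \<le> W x t n powr (\<sigma> t n - 1) * Uc \<sigma> \<alpha> v t n"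
    using Uc_pos[of t n] by (intro mult_right_mono) auto
  show "(\<Sum>k\<in>UNIV. W x t k powr \<sigma> t k) \<le> (\<Sum>k\<in>UNIV. W x' t k powr \<sigma> t k)"
    using W_pos[OF assms(1)] W_mono[OF assms(2)] \<sigma>_nonneg
    by (intro sum_mono powr_mono2) (auto intro: less_imp_le)
qed (use denominator_pos[OF assms(1)] Uc_pos[of t n] in auto)

lemma captured_demand_mono:
  assumes "\<And>i. x $ i \<ge> 0" "\<And>i. x $ i \<le> x' $ i"
  shows "captured_demand q \<sigma> \<alpha> v x \<le> captured_demand q \<sigma> \<alpha> v x'"
proof -
  have "x' $ i \<ge> 0" for i
    using assms by (meson order_trans)
  then show ?thesis
    using assms
    by (auto simp: captured_demand_eq intro!: sum_mono mult_left_mono lost_share_antimono q_nonneg)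
qed

section \<open>Comparison of the two programs\<close>

abbreviation "P1 \<equiv> MCP q \<sigma> \<alpha> v"

abbreviation P2 :: "nat \<Rightarrow> ('t, 'n, 'm) vars program" where "P2 \<equiv> CP q \<sigma> \<alpha> v"

lemma feasible_nonneg: "x \<in> feasible (P1 r) \<Longrightarrow> x $ i \<ge> 0"
  by (metis feasible_MCP_iff insertE singletonD order_refl zero_le_one)

text \<open>The exponent is the lower bound imposed on \<open>y\<close> minus the upper bound
  imposed on \<open>z\<close>, which links the lost share to the constraint on
  \<open>\<theta>\<close>.\<close>

lemma lost_share_conv_exp:
  assumes "\<And>i. x $ i \<ge> 0"
  shows "lost_share x t n = exp ((\<sigma> t n - 1) * ln (W x t n) + ln (Uc \<sigma> \<alpha> v t n)
    - ln (\<Sum>k\<in>UNIV. W x t k powr \<sigma> t k))"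
  using W_pos[OF assms, of t n] denominator_pos[OF assms, of t] Uc_pos[of t n]
  by (simp add: lost_share_def exp_diff exp_add powr_def)

text \<open>Since \<open>y\<close> is bounded below and \<open>z\<close> above,
  \<open>exp (y - z)\<close> and hence \<open>\<theta>\<close> dominate the lost share; with
  nonnegative demands the convex objective can only underestimate the captured demand.\<close>

lemma P2_relaxation:
  assumes "(x, y, z, \<theta>, U) \<in> feasible (P2 r)"
  shows "x \<in> feasible (P1 r)" "(\<Sum>i\<in>UNIV. x $ i) = real r"
    "objective (P2 r) (x, y, z, \<theta>, U) \<le> objective (P1 r) x"
proof -
  note f = assms[unfolded feasible_CP_iff[OF \<alpha>_nonneg Uc_pos]]
  then show x: "x \<in> feasible (P1 r)" and "(\<Sum>i\<in>UNIV. x $ i) = real r"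
    by (simp_all add: feasible_MCP_iff)
  note x0 = feasible_nonneg[OF x]
  have y: "(\<sigma> t n - 1) * ln (U $ t $ n) + ln (Uc \<sigma> \<alpha> v t n) \<le> y $ t $ n"
    and z: "z $ t \<le> ln (\<Sum>k\<in>UNIV. U $ t $ k powr \<sigma> t k)" for t n
    using f by blast+
  have U: "U $ t $ n = W x t n" for t n
    using f by (simp add: nest_weight_def new_attraction_def)
  have "lost_share x t n \<le> \<theta> $ t $ n" for t n
  proof -
    have "lost_share x t n \<le> exp (y $ t $ n - z $ t)"
      unfolding lost_share_conv_exp[OF x0] exp_le_cancel_iff
      by (intro diff_mono) (use y z in \<open>simp_all add: U\<close>)
    also have "\<dots> \<le> \<theta> $ t $ n"
      using f by simp
    finally show ?thesis .
  qed
  then show "objective (P2 r) (x, y, z, \<theta>, U) \<le> objective (P1 r) x"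
    by (auto simp: CP_def MCP_def captured_demand_eq[OF x0] intro!: sum_mono mult_left_mono q_nonneg)
qed

lemma P2_lift:
  assumes "x \<in> feasible (P1 r)" "(\<Sum>i\<in>UNIV. x $ i) = real r"
  obtains y z \<theta> U where "(x, y, z, \<theta>, U) \<in> feasible (P2 r)"
    "objective (P2 r) (x, y, z, \<theta>, U) = objective (P1 r) x"
proof
  note x0 = feasible_nonneg[OF assms(1)]
  let ?y = "\<chi> t n. (\<sigma> t n - 1) * ln (W x t n) + ln (Uc \<sigma> \<alpha> v t n)"
  let ?z = "\<chi> t. ln (\<Sum>k\<in>UNIV. W x t k powr \<sigma> t k)"
  let ?p = "(x, ?y, ?z, \<chi> t n. lost_share x t n, \<chi> t n. W x t n)"
  show "?p \<in> feasible (P2 r)"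
    using assms unfolding feasible_CP_iff[OF \<alpha>_nonneg Uc_pos]
    by (simp add: feasible_MCP_iff lost_share_conv_exp[OF x0])
       (simp add: nest_weight_def new_attraction_def)
  show "objective (P2 r) ?p = objective (P1 r) x"
    by (simp add: CP_def MCP_def captured_demand_eq[OF x0])
qed

end

section \<open>Binary vectors as sets of locations, and existence of an optimal choice\<close>

lemma sum_indicator_UNIV:
  "(\<Sum>i\<in>UNIV. (\<chi> i. if i \<in> S then 1 else (0::real)) $ i) = real (card S)"
  for S :: "'m::finite set"
  by (simp add: sum.If_cases)

lemma binary_vec_conv_indicator:
  fixes x :: "real ^ 'm"
  assumes "\<forall>i. x $ i \<in> {0, 1}"
  shows "x = (\<chi> i. if i \<in> {i. x $ i = 1} then 1 else 0)"
  using assms by (auto simp: vec_eq_iff)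

lemma binary_vec_extend:
  fixes x :: "real ^ 'm::finite"
  assumes "\<forall>i. x $ i \<in> {0, 1}" "(\<Sum>i\<in>UNIV. x $ i) \<le> real r" "r \<le> CARD('m)"
  obtains x' :: "real ^ 'm"
  where "\<forall>i. x' $ i \<in> {0, 1}" "(\<Sum>i\<in>UNIV. x' $ i) = real r" "\<forall>i. x $ i \<le> x' $ i"
proof -
  let ?S = "{i. x $ i = 1}"
  have "card ?S \<le> r"
    using assms(2) sum_indicator_UNIV[of ?S]
    unfolding binary_vec_conv_indicator[OF assms(1), symmetric] by simp
  \<comment> \<open>The set of open locations has at most \<open>r\<close> elements, and
    \<open>r \<le> CARD('m)\<close> leaves enough locations to enlarge it to exactly
    \<open>r\<close>.\<close>
  then obtain S where S: "?S \<subseteq> S" "card S = r"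
    using exists_subset_between[of ?S r UNIV] assms(3) by auto
  show thesis
  proof (rule that[of "\<chi> i. if i \<in> S then 1 else 0"])
    show "(\<Sum>i\<in>UNIV. (\<chi> i. if i \<in> S then 1 else (0::real)) $ i) = real r"
      unfolding sum_indicator_UNIV S(2) ..
  next
    show "\<forall>i. x $ i \<le> (\<chi> i. if i \<in> S then 1 else 0) $ i"
    proof
      fix i
      show "x $ i \<le> (\<chi> i. if i \<in> S then 1 else 0) $ i"
        using assms(1)[rule_format, of i] S(1) by auto
    qed
  qed auto
qed

lemma finite_feasible_MCP: "finite (feasible (MCP q \<sigma> \<alpha> v r))"
proof (rule finite_subset)
  show "feasible (MCP q \<sigma> \<alpha> v r) \<subseteq> range (\<lambda>S. \<chi> i. if i \<in> S then 1 else 0)"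
    using binary_vec_conv_indicator by (fastforce simp: feasible_MCP_iff)
qed simp

lemma optimal_iff:
  "optimal P p \<longleftrightarrow> p \<in> feasible P \<and> (\<forall>p'\<in>feasible P. objective P p' \<le> objective P p)"
  unfolding optimal_def is_arg_max_linorder by blast

text \<open>Opening nothing is feasible for every \<open>r\<close>, so the maximum is taken over a
  finite nonempty set.\<close>

lemma optimal_MCP_exists: "\<exists>x. optimal (MCP q \<sigma> \<alpha> v r) x"
proof -
  let ?F = "feasible (MCP q \<sigma> \<alpha> v r)" and ?f = "objective (MCP q \<sigma> \<alpha> v r)"
  have "0 \<in> ?F"
    by (simp add: feasible_MCP_iff)
  then obtain x where "x \<in> ?F" "?f x = Max (?f ` ?F)"
    using Max_in[of "?f ` ?F"] finite_feasible_MCP[of q \<sigma> \<alpha> v r] by fastforce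
  then show ?thesis
    using finite_feasible_MCP[of q \<sigma> \<alpha> v r] by (auto simp: optimal_iff)
qed

section \<open>Transfer of optimal solutions between the programs\<close>

context cross_nested_logit
begin

text \<open>Every feasible tuple is worth at most the captured demand of its own \<open>x'\<close>,
  hence at most the optimum at \<open>x\<close>, and the tight lift of \<open>x\<close> attains that
  value.\<close>

lemma optimal_lift:
  assumes "optimal (P1 r) x" "(\<Sum>i\<in>UNIV. x $ i) = real r"
  obtains y z \<theta> U where "optimal (P2 r) (x, y, z, \<theta>, U)"
    "objective (P2 r) (x, y, z, \<theta>, U) = objective (P1 r) x"
proof -
  have x: "x \<in> feasible (P1 r)" "\<And>x'. x' \<in> feasible (P1 r) \<Longrightarrow> objective (P1 r) x' \<le> objective (P1 r) x"
    using assms(1) by (auto simp: optimal_iff)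
  obtain y z \<theta> U where p: "(x, y, z, \<theta>, U) \<in> feasible (P2 r)"
    "objective (P2 r) (x, y, z, \<theta>, U) = objective (P1 r) x"
    using P2_lift[OF x(1) assms(2)] .
  have "objective (P2 r) p' \<le> objective (P2 r) (x, y, z, \<theta>, U)" if "p' \<in> feasible (P2 r)" for p'
  proof -
    obtain x' y' z' \<theta>' U' where p': "p' = (x', y', z', \<theta>', U')"
      by (rule prod_cases5)
    show ?thesis
      using P2_relaxation(3)[OF that[unfolded p']] x(2)[OF P2_relaxation(1)[OF that[unfolded p']]]
      unfolding p' p(2) by (rule order_trans)
  qed
  with p show thesis
    by (intro that) (auto simp: optimal_iff)
qed

lemma optimal_extend:
  assumes "optimal (P1 r) x" "r \<le> CARD('m)"
  obtains x' where "\<forall>i. x $ i \<le> x' $ i" "optimal (P1 r) x'" "(\<Sum>i\<in>UNIV. x' $ i) = real r"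
proof -
  have x: "x \<in> feasible (P1 r)"
    using assms(1) by (simp add: optimal_iff)
  then obtain x' where x': "\<forall>i. x' $ i \<in> {0, 1}" "(\<Sum>i\<in>UNIV. x' $ i) = real r" "\<forall>i. x $ i \<le> x' $ i"
    using binary_vec_extend[OF _ _ assms(2), of x] by (auto simp: feasible_MCP_iff)
  then have "x' \<in> feasible (P1 r)"
    by (simp add: feasible_MCP_iff)
  moreover have "objective (P1 r) x \<le> objective (P1 r) x'"
    using captured_demand_mono[of x x'] feasible_nonneg[OF x] x'(3) by (simp add: MCP_def)
  ultimately have "optimal (P1 r) x'"
    using assms(1) by (auto simp: optimal_iff intro: order_trans)
  with x' that show thesis by blast
qed

text \<open>Lifting an optimal location choice that exhausts the budget shows that the optimal tuple
  is worth at least the optimum of \<open>P1 r\<close>. The relaxation bound gives the reverse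
  inequality, so the chain collapses to equalities.\<close>

lemma optimal_project:
  assumes "optimal (P2 r) (x, y, z, \<theta>, U)" "r \<le> CARD('m)"
  shows "optimal (P1 r) x" "objective (P2 r) (x, y, z, \<theta>, U) = objective (P1 r) x"
proof -
  obtain x0 where "optimal (P1 r) x0"
    using optimal_MCP_exists by blast
  then obtain x' where x': "optimal (P1 r) x'" "(\<Sum>i\<in>UNIV. x' $ i) = real r"
    using optimal_extend assms(2) by metis
  obtain y' z' \<theta>' U' where "optimal (P2 r) (x', y', z', \<theta>', U')"
    "objective (P2 r) (x', y', z', \<theta>', U') = objective (P1 r) x'"
    using optimal_lift[OF x'] .
  then have le: "objective (P1 r) x' \<le> objective (P2 r) (x, y, z, \<theta>, U)"
    using assms(1) by (metis optimal_iff)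
  have x: "x \<in> feasible (P1 r)" "objective (P2 r) (x, y, z, \<theta>, U) \<le> objective (P1 r) x"
    using P2_relaxation assms(1) by (auto simp: optimal_iff)
  then have eq: "objective (P1 r) x = objective (P1 r) x'"
    using x'(1) le by (force simp: optimal_iff)
  then show "optimal (P1 r) x"
    using x'(1) x(1) by (simp add: optimal_iff)
  show "objective (P2 r) (x, y, z, \<theta>, U) = objective (P1 r) x"
    using eq le x(2) by simp
qed

end

theorem theorem2:
  fixes q :: "'t::finite \<Rightarrow> real"
    and \<sigma> :: "'t \<Rightarrow> 'n::finite \<Rightarrow> real"
    and \<alpha> :: "'t \<Rightarrow> 'm::finite + 'c::finite \<Rightarrow> 'n \<Rightarrow> real"
    and v :: "'t \<Rightarrow> 'm + 'c \<Rightarrow> real"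
    and r :: nat
  assumes "\<And>t. q t \<ge> 0"
    and "\<And>t n. 0 < \<sigma> t n \<and> \<sigma> t n \<le> 1"
    and "\<And>t i n. \<alpha> t i n \<ge> 0"
    and "\<And>t i. (\<Sum>n\<in>UNIV. \<alpha> t (Inl i) n) = 1"
    and "\<And>t n. Uc \<sigma> \<alpha> v t n > 0"
    and "r \<le> CARD('m)"
  shows "mixed_binary_convex_program (CP q \<sigma> \<alpha> v r)
    \<and> (\<exists>x. optimal (MCP q \<sigma> \<alpha> v r) x)
    \<and> (\<exists>p. optimal (CP q \<sigma> \<alpha> v r) p)
    \<and> (\<forall>x p. optimal (MCP q \<sigma> \<alpha> v r) x \<and> optimal (CP q \<sigma> \<alpha> v r) p \<longrightarrow>
          objective (MCP q \<sigma> \<alpha> v r) x = objective (CP q \<sigma> \<alpha> v r) p)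
    \<and> (\<forall>x y z \<theta> W. optimal (CP q \<sigma> \<alpha> v r) (x, y, z, \<theta>, W) \<longrightarrow> optimal (MCP q \<sigma> \<alpha> v r) x)
    \<and> (\<forall>x. optimal (MCP q \<sigma> \<alpha> v r) x \<and> (\<Sum>i\<in>UNIV. x $ i) = real r \<longrightarrow>
          (\<exists>y z \<theta> W. optimal (CP q \<sigma> \<alpha> v r) (x, y, z, \<theta>, W)))
    \<and> (\<forall>x. optimal (MCP q \<sigma> \<alpha> v r) x \<longrightarrow>
          (\<exists>x' y z \<theta> W. (\<forall>i. x $ i \<le> x' $ i) \<and> optimal (CP q \<sigma> \<alpha> v r) (x', y, z, \<theta>, W)))"
proof -
  interpret cross_nested_logit q \<sigma> \<alpha> v
    using assms by unfold_locales (auto intro: less_imp_le)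
  have extend: "\<exists>x' y z \<theta> W. (\<forall>i. x $ i \<le> x' $ i) \<and> optimal (P2 r) (x', y, z, \<theta>, W)"
    if "optimal (P1 r) x" for x
    using optimal_extend[OF that \<open>r \<le> CARD('m)\<close>] optimal_lift by metis
  show ?thesis
  proof (intro conjI allI impI; (elim conjE)?)
    show "mixed_binary_convex_program (P2 r)"
      using \<sigma>_nonneg \<sigma>_le_1 by (intro mixed_binary_convex_program_CP) simp
    show "\<exists>x. optimal (P1 r) x"
      by (rule optimal_MCP_exists)
    \<comment> \<open>The feasible set of \<open>P2 r\<close> may be unbounded, so no compactness is
      invoked: an optimum is obtained by padding an optimal location choice and lifting it.\<close>
    then show "\<exists>p. optimal (P2 r) p"
      using extend by blast
    show "objective (P1 r) x = objective (P2 r) p" if "optimal (P1 r) x" "optimal (P2 r) p" for x p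
    proof -
      obtain x' y z \<theta> W where p: "p = (x', y, z, \<theta>, W)"
        by (rule prod_cases5)
      \<comment> \<open>The location part \<open>x'\<close> of \<open>p\<close> is itself optimal
        for \<open>P1 r\<close> and has the value of \<open>p\<close>, so only two optima of the
        same program remain to be compared.\<close>
      note x' = optimal_project[OF that(2)[unfolded p] \<open>r \<le> CARD('m)\<close>]
      show ?thesis
        using that(1) x'(1) unfolding p x'(2) by (auto simp: optimal_iff intro: order_antisym)
    qed
    show "optimal (P1 r) x" if "optimal (P2 r) (x, y, z, \<theta>, W)" for x y z \<theta> W
      using optimal_project(1)[OF that \<open>r \<le> CARD('m)\<close>] .
    show "\<exists>y z \<theta> W. optimal (P2 r) (x, y, z, \<theta>, W)"
      if "optimal (P1 r) x" "(\<Sum>i\<in>UNIV. x $ i) = real r" for x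
      using optimal_lift[OF that] by metis
    show "\<exists>x' y z \<theta> W. (\<forall>i. x $ i \<le> x' $ i) \<and> optimal (P2 r) (x', y, z, \<theta>, W)"
      if "optimal (P1 r) x" for x
      using extend[OF that] .
  qed
qed

end
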